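(* Let $m_0\geq 6$ and $m_1\ge 1$ be integers and, for $v\in\mathbb{R}$, let $r_v$ be the solution of the $(m_0,m_1)$-ODE with initial values $r_v(0)=0$ and $\dot r_v(0)=v$. Then there is a constant $N$, depending only on $m_0$ and $m_1$, such that for every $v\in\mathbb{R}$ the nodal number of $r_v$ is at most $N$.
   Context: For positive integers $m_0,m_1$, the $(m_0,m_1)$-ODE for a function $r:(0,\tfrac{\pi}{2})\to\mathbb{R}$ is $$\ddot r(t)=\left((m_1-m_0)\csc 2t-(m_0+m_1)\cot 2t\right)\dot r(t)-m_1\frac{\sin 2r(t)}{2\cos^2 t}+m_0\frac{\sin 2r(t)}{2\sin^2 t}.$$ For every $v\in\mathbb{R}$ there is a unique solution $r_v$ on $[0,\tfrac{\pi}{2})$ with $r_v(0)=0$ and $\dot r_v(0)=v$. The nodal number of $r_v$ is the number of $t\in(0,\tfrac{\pi}{2})$ with $r_v(t)=\tfrac{\pi}{2}$. *)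

theory Defs
  imports Complex_Main "HOL-Library.Extended_Nat"
begin

definition ode_rhs :: "nat \<Rightarrow> nat \<Rightarrow> real \<Rightarrow> real \<Rightarrow> real \<Rightarrow> real" where
  "ode_rhs m0 m1 t x y =
     ((real m1 - real m0) * (1 / sin (2 * t)) - (real m0 + real m1) * cot (2 * t)) * y
     - real m1 * (sin (2 * x) / (2 * (cos t)^2))
     + real m0 * (sin (2 * x) / (2 * (sin t)^2))"

text \<open>
  The equation is imposed on the open interval only, since its coefficients are singular at 0;
  the initial velocity is the one-sided derivative at 0. Values of \<open>r\<close> outside
  \<open>{0..<pi/2}\<close> are irrelevant.
\<close>

definition is_ivp_solution :: "nat \<Rightarrow> nat \<Rightarrow> real \<Rightarrow> (real \<Rightarrow> real) \<Rightarrow> bool" where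
  "is_ivp_solution m0 m1 v r \<longleftrightarrow>
     r 0 = 0 \<and>
     (\<exists>r'. r' 0 = v \<and>
        (\<forall>t\<in>{0..<pi/2}. (r has_real_derivative r' t) (at t within {0..<pi/2})) \<and>
        (\<forall>t\<in>{0<..<pi/2}. (r' has_real_derivative ode_rhs m0 m1 t (r t) (r' t)) (at t)))"

text \<open>Extended-natural-valued, because \<open>card\<close> of an infinite set is 0.\<close>

definition nodal_number :: "(real \<Rightarrow> real) \<Rightarrow> enat" where
  "nodal_number r =
     (let S = {t \<in> {0<..<pi/2}. r t = pi/2} in if finite S then enat (card S) else \<infinity>)"

end

theory Submission
  imports Defs "HOL-Analysis.Analysis"
begin

text \<open>
  Put \<open>w = r - pi/2\<close>, so that nodes of \<open>r\<close> are zeros of \<open>w\<close>. The equation becomes that of a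
  damped pendulum with variable coefficients,
  \<open>w'' + P w' + q sin w cos w = 0\<close>, where \<open>P = m0 cot t - m1 tan t\<close> and
  \<open>q = m0 / sin\<^sup>2 t - m1 / cos\<^sup>2 t\<close>.
  Each point of the closed interval \<open>{0..pi/2}\<close> has a neighbourhood, independent of the initial
  velocity, in which no solution has two zeros. Finitely many of these neighbourhoods cover the
  interval, and their number bounds the nodal number.

  Away from \<open>pi/2\<close> the neighbourhoods come from Sturm comparison. Since
  \<open>\<bar>sin w cos w\<bar> \<le> \<bar>w\<bar>\<close>, the pendulum oscillates no faster than the linear equation
  \<open>y'' + P y' + \<bar>q\<bar> y = 0\<close>, and a positive function \<open>y\<close> with
  \<open>y'' + P y' + \<bar>q\<bar> y < 0\<close> keeps zeros of \<open>w\<close> apart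
  (\<open>supersolution_imp_at_most_one_zero\<close>). At an interior point a downward parabola is such a
  \<open>y\<close>. At the singular point \<open>0\<close> the linear equation looks like the Euler equation
  \<open>y'' + (m0 / t) y' + (m0 / t\<^sup>2) y = 0\<close>, and \<open>t powr (- a)\<close> is a strict supersolution of it
  iff \<open>a\<^sup>2 - (m0 - 1) a + m0 < 0\<close>. This has a real solution \<open>a\<close> iff
  \<open>m0\<^sup>2 - 6 m0 + 1 > 0\<close>, which for positive integers means \<open>m0 \<ge> 6\<close>;
  then \<open>a = 5/2\<close> is one.

  Near \<open>pi/2\<close> the coefficient \<open>q\<close> is negative and unbounded, and \<open>sin w cos w\<close> may have either
  sign relative to \<open>w\<close>. There the energy \<open>(p w')\<^sup>2 + p\<^sup>2 q (sin w)\<^sup>2\<close> with the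
  integrating factor \<open>p = (sin t)^m0 (cos t)^m1\<close> is monotone, because \<open>p\<^sup>2 q\<close> is. It is
  positive at a zero of \<open>w\<close> but nonpositive at a turning point, so two zeros cannot have a
  turning point between them (\<open>monotone_energy_imp_at_most_one_zero\<close>).

  Both arguments need the zeros of \<open>w\<close> to be simple: a double zero would force
  \<open>r = pi/2\<close> on the whole interval, against \<open>r 0 = 0\<close>.
\<close>

section \<open>Pendulum equations with variable coefficients\<close>

text \<open>
  The velocity \<open>w'\<close> is carried along as a second function: it makes the equation a first-order
  system, and the solutions of the geometric problem come with such a pair.
\<close>

definition pendulum_solution ::
    "(real \<Rightarrow> real) \<Rightarrow> (real \<Rightarrow> real) \<Rightarrow> real set \<Rightarrow> (real \<Rightarrow> real) \<Rightarrow> (real \<Rightarrow> real) \<Rightarrow> bool" where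
  "pendulum_solution P q I w w' \<longleftrightarrow>
     (\<forall>t\<in>I. (w has_real_derivative w' t) (at t) \<and>
        (w' has_real_derivative - P t * w' t - q t * (sin (w t) * cos (w t))) (at t))"

lemma pendulum_solutionD:
  assumes "pendulum_solution P q I w w'" "t \<in> I"
  shows "(w has_real_derivative w' t) (at t)"
    and "(w' has_real_derivative - P t * w' t - q t * (sin (w t) * cos (w t))) (at t)"
  using assms by (auto simp: pendulum_solution_def)

lemma pendulum_solution_uminus:
  assumes "pendulum_solution P q I w w'"
  shows "pendulum_solution P q I (\<lambda>t. - w t) (\<lambda>t. - w' t)"
  unfolding pendulum_solution_def
  by (auto intro!: derivative_eq_intros pendulum_solutionD[OF assms])

text \<open>
  Gronwall's inequality in both time directions: \<open>exp (- K t) E t\<close> does not increase and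
  \<open>exp (K t) E t\<close> does not decrease.
\<close>

lemma gronwall_zero:
  fixes E E' :: "real \<Rightarrow> real"
  assumes deriv: "\<And>s. s \<in> {a..b} \<Longrightarrow> (E has_real_derivative E' s) (at s)"
    and bound: "\<And>s. s \<in> {a..b} \<Longrightarrow> \<bar>E' s\<bar> \<le> K * E s"
    and nonneg: "\<And>s. s \<in> {a..b} \<Longrightarrow> 0 \<le> E s"
    and "c \<in> {a..b}" "t \<in> {a..b}" "E c = 0"
  shows "E t = 0"
proof (cases "c \<le> t")
  case True
  have "exp (- K * t) * E t \<le> exp (- K * c) * E c"
  proof (rule DERIV_nonpos_imp_nonincreasing[OF True])
    fix s assume "c \<le> s" "s \<le> t"
    then have s: "s \<in> {a..b}" using assms by auto
    have "((\<lambda>s. exp (- K * s) * E s) has_real_derivative exp (- K * s) * (E' s - K * E s)) (at s)"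
      by (auto intro!: derivative_eq_intros deriv[OF s] simp: algebra_simps)
    moreover have "exp (- K * s) * (E' s - K * E s) \<le> 0"
      using bound[OF s] by (auto simp: mult_le_0_iff)
    ultimately show "\<exists>y. ((\<lambda>s. exp (- K * s) * E s) has_real_derivative y) (at s) \<and> y \<le> 0" by blast
  qed
  with \<open>E c = 0\<close> nonneg[OF \<open>t \<in> {a..b}\<close>] show ?thesis by (simp add: mult_le_0_iff)
next
  case False
  then have "t \<le> c" by simp
  have "exp (K * t) * E t \<le> exp (K * c) * E c"
  proof (rule DERIV_nonneg_imp_nondecreasing[OF \<open>t \<le> c\<close>])
    fix s assume "t \<le> s" "s \<le> c"
    then have s: "s \<in> {a..b}" using assms by auto
    have "((\<lambda>s. exp (K * s) * E s) has_real_derivative exp (K * s) * (E' s + K * E s)) (at s)"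
      by (auto intro!: derivative_eq_intros deriv[OF s] simp: algebra_simps)
    moreover have "0 \<le> exp (K * s) * (E' s + K * E s)"
      using bound[OF s] by (auto simp: zero_le_mult_iff)
    ultimately show "\<exists>y. ((\<lambda>s. exp (K * s) * E s) has_real_derivative y) (at s) \<and> 0 \<le> y" by blast
  qed
  with \<open>E c = 0\<close> nonneg[OF \<open>t \<in> {a..b}\<close>] show ?thesis by (simp add: mult_le_0_iff)
qed

lemma abs_sin_cos_le: "\<bar>sin x * cos x\<bar> \<le> \<bar>x :: real\<bar>"
proof -
  have "\<bar>sin x * cos x\<bar> \<le> \<bar>sin x\<bar> * 1"
    unfolding abs_mult by (intro mult_left_mono) auto
  then show ?thesis using abs_sin_x_le_abs_x[of x] by simp
qed

text \<open>
  Uniqueness for the zero solution: \<open>w\<^sup>2 + w'\<^sup>2\<close> obeys a Gronwall inequality on every compact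
  subinterval, since the coefficients are bounded there and \<open>\<bar>sin w cos w\<bar> \<le> \<bar>w\<bar>\<close>.
\<close>

lemma pendulum_double_zero_imp_zero:
  assumes sol: "pendulum_solution P q {l<..<u} w w'"
    and P: "continuous_on {l<..<u} P" and q: "continuous_on {l<..<u} q"
    and c: "c \<in> {l<..<u}" "w c = 0" "w' c = 0" and t: "t \<in> {l<..<u}"
  shows "w t = 0"
proof -
  define a b where "a = min c t" and "b = max c t"
  have sub: "{a..b} \<subseteq> {l<..<u}" using c t by (auto simp: a_def b_def)
  have "bounded (P ` {a..b})" "bounded (q ` {a..b})"
    using continuous_on_subset[OF P sub] continuous_on_subset[OF q sub]
    by (auto intro!: compact_imp_bounded compact_continuous_image)
  then obtain A B where A: "\<And>s. s \<in> {a..b} \<Longrightarrow> \<bar>P s\<bar> \<le> A" and B: "\<And>s. s \<in> {a..b} \<Longrightarrow> \<bar>q s\<bar> \<le> B"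
    by (force simp: bounded_iff)
  let ?E = "\<lambda>s. (w s)\<^sup>2 + (w' s)\<^sup>2"
  let ?E' = "\<lambda>s. 2 * w s * w' s + 2 * w' s * (- P s * w' s - q s * (sin (w s) * cos (w s)))"
  have "?E t = 0"
  proof (rule gronwall_zero[where E = ?E and E' = ?E' and a = a and b = b and c = c and K = "1 + 2 * A + B"])
    fix s assume s: "s \<in> {a..b}"
    show "(?E has_real_derivative ?E' s) (at s)"
      using sub s by (auto intro!: derivative_eq_intros pendulum_solutionD[OF sol])
    have xy: "2 * \<bar>w s\<bar> * \<bar>w' s\<bar> \<le> ?E s"
      using sum_squares_bound[of "\<bar>w s\<bar>" "\<bar>w' s\<bar>"] by simp
    have "\<bar>?E' s\<bar> \<le> \<bar>2 * w s * w' s\<bar> + \<bar>2 * w' s * (P s * w' s)\<bar>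
        + \<bar>2 * w' s * (q s * (sin (w s) * cos (w s)))\<bar>"
      by (simp add: algebra_simps)
    also have "\<dots> = 2 * \<bar>w s\<bar> * \<bar>w' s\<bar> + \<bar>P s\<bar> * (2 * (w' s)\<^sup>2)
        + \<bar>q s\<bar> * (2 * \<bar>sin (w s) * cos (w s)\<bar> * \<bar>w' s\<bar>)"
      by (simp add: abs_mult power2_eq_square)
    also have "\<dots> \<le> ?E s + A * (2 * ?E s) + B * ?E s"
    proof (intro add_mono mult_mono)
      have "2 * \<bar>sin (w s) * cos (w s)\<bar> * \<bar>w' s\<bar> \<le> 2 * \<bar>w s\<bar> * \<bar>w' s\<bar>"
        by (intro mult_right_mono mult_left_mono abs_sin_cos_le) auto
      then show "2 * \<bar>sin (w s) * cos (w s)\<bar> * \<bar>w' s\<bar> \<le> ?E s" using xy by linarith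
      show "0 \<le> A" "0 \<le> B" using A[OF s] B[OF s] by linarith+
    qed (use xy A[OF s] B[OF s] in auto)
    finally show "\<bar>?E' s\<bar> \<le> (1 + 2 * A + B) * ?E s" by (simp add: algebra_simps)
  qed (use c in \<open>auto simp: a_def b_def\<close>)
  then show ?thesis by (simp add: sum_power2_eq_zero_iff)
qed

section \<open>Two criteria that exclude a second zero\<close>

text \<open>
  A maximum principle for \<open>w / y\<close>. At a positive interior maximum \<open>m\<close> the Wronskian
  \<open>W = w' y - w y'\<close> vanishes, and the strict supersolution inequality gives it a positive
  derivative there. So \<open>W\<close>, and with it the derivative \<open>W / y\<^sup>2\<close> of \<open>w / y\<close>, is positive just
  to the right of \<open>m\<close>, where \<open>w / y\<close> would then exceed its maximum.
\<close>

lemma pendulum_nonpos_between_zeros: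
  assumes sol: "pendulum_solution P q {a..b} w w'"
    and y: "\<And>t. t \<in> {a..b} \<Longrightarrow> (y has_real_derivative y' t) (at t)"
    and y': "\<And>t. t \<in> {a..b} \<Longrightarrow> (y' has_real_derivative y'' t) (at t)"
    and pos: "\<And>t. t \<in> {a..b} \<Longrightarrow> 0 < y t"
    and super: "\<And>t. t \<in> {a..b} \<Longrightarrow> y'' t + P t * y' t + \<bar>q t\<bar> * y t < 0"
    and zeros: "w a = 0" "w b = 0" and s: "s \<in> {a..b}"
  shows "w s \<le> 0"
proof (rule ccontr)
  assume "\<not> w s \<le> 0"
  let ?z = "\<lambda>t. w t / y t" and ?W = "\<lambda>t. w' t * y t - w t * y' t"
  have dz: "(?z has_real_derivative ?W t / (y t)\<^sup>2) (at t)" if "t \<in> {a..b}" for t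
    using pos[OF that]
    by (auto intro!: derivative_eq_intros pendulum_solutionD[OF sol] y that simp: power2_eq_square)
  have "continuous_on {a..b} ?z"
    by (intro continuous_at_imp_continuous_on ballI DERIV_isCont[OF dz])
  then obtain m where m: "m \<in> {a..b}" and max: "\<And>t. t \<in> {a..b} \<Longrightarrow> ?z t \<le> ?z m"
    using continuous_attains_sup[of "{a..b}" ?z] s by auto
  have "0 < ?z s" using \<open>\<not> w s \<le> 0\<close> pos[OF s] by simp
  then have "0 < ?z m" using max[OF s] by linarith
  then have wm: "0 < w m" using pos[OF m] by (simp add: zero_less_divide_iff)
  then have ab: "a < m" "m < b" using m zeros by (auto simp: less_le)
  have "?W m / (y m)\<^sup>2 = 0"
    by (rule DERIV_local_max[OF dz[OF m], of "min (m - a) (b - m)"])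
      (use ab max in \<open>auto simp: abs_if split: if_splits\<close>)
  then have Wm: "w' m * y m = w m * y' m" using pos[OF m] by simp
  let ?D = "(- P m * w' m - q m * (sin (w m) * cos (w m))) * y m - w m * y'' m"
  have "(?W has_real_derivative ?D) (at m)"
    by (auto intro!: derivative_eq_intros pendulum_solutionD[OF sol] y y' m simp: algebra_simps)
  moreover have "0 < ?D"
  proof -
    have "q m * (sin (w m) * cos (w m)) \<le> \<bar>q m\<bar> * w m"
      using abs_sin_cos_le[of "w m"] wm
      by (metis abs_ge_self abs_mult abs_of_pos mult_left_mono abs_ge_zero order_trans)
    then have "q m * (sin (w m) * cos (w m)) * y m \<le> \<bar>q m\<bar> * w m * y m"
      using pos[OF m] by (simp add: mult_right_mono)
    moreover have "w m * (y'' m + P m * y' m + \<bar>q m\<bar> * y m) < 0"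
      using super[OF m] wm by (simp add: mult_pos_neg)
    moreover have D: "?D = - P m * (w m * y' m) - q m * (sin (w m) * cos (w m)) * y m - w m * y'' m"
      unfolding Wm[symmetric] by (simp add: algebra_simps)
    ultimately show ?thesis unfolding D by (simp add: algebra_simps)
  qed
  ultimately obtain d where d: "d > 0" and inc: "\<And>h. 0 < h \<Longrightarrow> h < d \<Longrightarrow> ?W m < ?W (m + h)"
    using DERIV_pos_inc_right by blast
  define n where "n = min (m + d / 2) b"
  have n: "m < n" "n \<le> b" "n < m + d" using d ab by (auto simp: n_def)
  obtain x where x: "m < x" "x < n" "?z n - ?z m = (n - m) * (?W x / (y x)\<^sup>2)"
    using MVT2[of m n ?z "\<lambda>t. ?W t / (y t)\<^sup>2"] dz n ab by auto
  have "0 < ?W x" using inc[of "x - m"] x n Wm by simp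
  then have "0 < (n - m) * (?W x / (y x)\<^sup>2)"
    using n pos[of x] x ab by (intro mult_pos_pos divide_pos_pos) auto
  then show False using max[of n] x n ab by auto
qed

lemma pendulum_turning_point:
  assumes sol: "pendulum_solution P q {a..b} w w'"
    and simple: "\<And>t. t \<in> {a..b} \<Longrightarrow> w t = 0 \<Longrightarrow> w' t \<noteq> 0"
    and "a < b" "w a = 0" "w b = 0"
  obtains m where "m \<in> {a<..<b}" "w' m = 0" "w m \<noteq> 0"
proof -
  have "\<exists>m. a < m \<and> m < b \<and> w b - w a = (b - a) * w' m"
    using MVT2[of a b w w'] pendulum_solutionD(1)[OF sol] \<open>a < b\<close> by auto
  then obtain m where "a < m" "m < b" "w' m = 0" using assms by auto
  then show thesis using that simple[of m] by auto
qed

text \<open>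
  By the maximum principle for \<open>w\<close> and for \<open>- w\<close>, the function \<open>w\<close> would vanish throughout
  \<open>{a..b}\<close>; but it does not vanish at a turning point.
\<close>

lemma supersolution_imp_at_most_one_zero:
  assumes sol: "pendulum_solution P q {a..b} w w'"
    and simple: "\<And>t. t \<in> {a..b} \<Longrightarrow> w t = 0 \<Longrightarrow> w' t \<noteq> 0"
    and y: "\<And>t. t \<in> {a..b} \<Longrightarrow> (y has_real_derivative y' t) (at t)"
    and y': "\<And>t. t \<in> {a..b} \<Longrightarrow> (y' has_real_derivative y'' t) (at t)"
    and pos: "\<And>t. t \<in> {a..b} \<Longrightarrow> 0 < y t"
    and super: "\<And>t. t \<in> {a..b} \<Longrightarrow> y'' t + P t * y' t + \<bar>q t\<bar> * y t < 0"
    and zeros: "w a = 0" "w b = 0"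
  shows "\<not> a < b"
proof
  assume "a < b"
  then obtain m where m: "m \<in> {a<..<b}" "w m \<noteq> 0"
    using pendulum_turning_point[OF sol simple _ zeros] by blast
  have "w m \<le> 0"
    using pendulum_nonpos_between_zeros[OF sol y y' pos super zeros] m by auto
  moreover have "- w m \<le> 0"
    using pendulum_nonpos_between_zeros[OF pendulum_solution_uminus[OF sol] y y' pos super] zeros m
    by auto
  ultimately show False using m by simp
qed

text \<open>
  With the integrating factor \<open>p\<close>, \<open>p' = p P\<close>, the energy
  \<open>F = (p w')\<^sup>2 + p\<^sup>2 q (sin w)\<^sup>2\<close> satisfies \<open>F' = (p\<^sup>2 q)' (sin w)\<^sup>2\<close>: all terms with
  \<open>w'\<close> cancel. If \<open>F\<close> increases, compare the first zero with the turning point, and if it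
  decreases, the turning point with the second zero.
\<close>

lemma monotone_energy_imp_at_most_one_zero:
  assumes sol: "pendulum_solution P q {a..b} w w'"
    and simple: "\<And>t. t \<in> {a..b} \<Longrightarrow> w t = 0 \<Longrightarrow> w' t \<noteq> 0"
    and p: "\<And>t. t \<in> {a..b} \<Longrightarrow> (p has_real_derivative p t * P t) (at t)"
    and pos: "\<And>t. t \<in> {a..b} \<Longrightarrow> 0 < p t"
    and q: "\<And>t. t \<in> {a..b} \<Longrightarrow> q t \<le> 0"
    and pq: "\<And>t. t \<in> {a..b} \<Longrightarrow> ((\<lambda>t. (p t)\<^sup>2 * q t) has_real_derivative k t) (at t)"
    and sign: "(\<forall>t\<in>{a..b}. 0 \<le> k t) \<or> (\<forall>t\<in>{a..b}. k t \<le> 0)"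
    and zeros: "w a = 0" "w b = 0"
  shows "\<not> a < b"
proof
  assume "a < b"
  then obtain m where m: "m \<in> {a<..<b}" "w' m = 0"
    using pendulum_turning_point[OF sol simple _ zeros] by blast
  define F where "F = (\<lambda>t. (p t * w' t)\<^sup>2 + (p t)\<^sup>2 * q t * (sin (w t))\<^sup>2)"
  have dF: "(F has_real_derivative k t * (sin (w t))\<^sup>2) (at t)" if "t \<in> {a..b}" for t
    unfolding F_def
    by (rule derivative_eq_intros p[OF that] pq[OF that] pendulum_solutionD[OF sol that] refl)+
      (simp add: algebra_simps power2_eq_square)
  have Fm: "F m \<le> 0"
    using m q[of m] by (auto simp: F_def mult_le_0_iff)
  have F0: "0 < F t" if "t \<in> {a..b}" "w t = 0" for t
    using simple[OF that] pos[OF that(1)] that by (simp add: F_def)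
  from sign show False
  proof
    assume "\<forall>t\<in>{a..b}. 0 \<le> k t"
    then have "F a \<le> F m"
      using m by (intro DERIV_nonneg_imp_nondecreasing[of a m F]) (force intro: dF)+
    then show False using F0[of a] Fm \<open>a < b\<close> zeros by auto
  next
    assume "\<forall>t\<in>{a..b}. k t \<le> 0"
    then have "F b \<le> F m"
      using m by (intro DERIV_nonpos_imp_nonincreasing[of m b F]) (force intro: dF simp: mult_le_0_iff)+
    then show False using F0[of b] Fm \<open>a < b\<close> zeros by auto
  qed
qed

section \<open>Nodes as simple zeros of a pendulum solution\<close>

definition damping :: "nat \<Rightarrow> nat \<Rightarrow> real \<Rightarrow> real" where
  "damping m0 m1 t = real m0 * (cos t / sin t) - real m1 * (sin t / cos t)"

definition stiffness :: "nat \<Rightarrow> nat \<Rightarrow> real \<Rightarrow> real" where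
  "stiffness m0 m1 t = real m0 / (sin t)\<^sup>2 - real m1 / (cos t)\<^sup>2"

lemma sin_cos_pos:
  assumes "t \<in> {0<..<pi/2}"
  shows "0 < sin t" "0 < cos t"
  using assms by (auto intro: sin_gt_zero2 cos_gt_zero)

lemma continuous_on_damping: "continuous_on {0<..<pi/2} (damping m0 m1)"
  unfolding damping_def by (intro continuous_intros ballI) (use sin_cos_pos in force)+

lemma continuous_on_stiffness: "continuous_on {0<..<pi/2} (stiffness m0 m1)"
  unfolding stiffness_def by (intro continuous_intros ballI) (use sin_cos_pos in force)+

lemma ode_rhs_eq_pendulum:
  assumes "t \<in> {0<..<pi/2}"
  shows "ode_rhs m0 m1 t x y =
    - damping m0 m1 t * y - stiffness m0 m1 t * (sin (x - pi/2) * cos (x - pi/2))"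
proof -
  note pos = sin_cos_pos[OF assms]
  have "(real m1 - real m0) * (1 / sin (2 * t)) - (real m0 + real m1) * cot (2 * t)
     = ((real m1 - real m0) * ((sin t)\<^sup>2 + (cos t)\<^sup>2) - (real m0 + real m1) * ((cos t)\<^sup>2 - (sin t)\<^sup>2))
         / (2 * sin t * cos t)"
    by (simp add: cot_def sin_double cos_double diff_divide_distrib right_diff_distrib)
  also have "\<dots> = (2 * real m1 * (sin t)\<^sup>2 - 2 * real m0 * (cos t)\<^sup>2) / (2 * sin t * cos t)"
    by (simp add: algebra_simps del: sin_cos_squared_add sin_cos_squared_add2)
  also have "\<dots> = - damping m0 m1 t"
    using pos by (simp add: damping_def field_simps power2_eq_square)
  finally have damp: "(real m1 - real m0) * (1 / sin (2 * t)) - (real m0 + real m1) * cot (2 * t)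
     = - damping m0 m1 t" .
  have shift: "sin (x - pi/2) * cos (x - pi/2) = - (sin (2 * x) / 2)"
    by (simp add: sin_diff cos_diff sin_double)
  show ?thesis
    unfolding ode_rhs_def damp shift stiffness_def by (simp add: algebra_simps)
qed

text \<open>
  The shifted solution has only simple zeros: after a double zero \<open>r\<close> would be constantly
  \<open>pi/2\<close> on the open interval, and its continuity at \<open>0\<close> contradicts \<open>r 0 = 0\<close>.
\<close>

lemma nodal_function:
  assumes "is_ivp_solution m0 m1 v r"
  obtains w' where "pendulum_solution (damping m0 m1) (stiffness m0 m1) {0<..<pi/2} (\<lambda>t. r t - pi/2) w'"
    and "\<And>t. t \<in> {0<..<pi/2} \<Longrightarrow> r t - pi/2 = 0 \<Longrightarrow> w' t \<noteq> 0"
proof -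
  from assms obtain r' where r0: "r 0 = 0"
    and r: "\<And>t. t \<in> {0..<pi/2} \<Longrightarrow> (r has_real_derivative r' t) (at t within {0..<pi/2})"
    and r': "\<And>t. t \<in> {0<..<pi/2} \<Longrightarrow> (r' has_real_derivative ode_rhs m0 m1 t (r t) (r' t)) (at t)"
    unfolding is_ivp_solution_def by blast
  have sol: "pendulum_solution (damping m0 m1) (stiffness m0 m1) {0<..<pi/2} (\<lambda>t. r t - pi/2) r'"
    unfolding pendulum_solution_def
  proof (intro ballI conjI)
    fix t assume t: "t \<in> {0<..<pi/2}"
    then have "at t within {0..<pi/2} = at t"
      by (intro at_within_open_subset[of _ "{0<..<pi/2}"]) auto
    moreover have "t \<in> {0..<pi/2}" using t by auto
    ultimately have "(r has_real_derivative r' t) (at t)" using r[of t] by metis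
    then show "((\<lambda>t. r t - pi/2) has_real_derivative r' t) (at t)"
      by (auto intro!: derivative_eq_intros)
    show "(r' has_real_derivative - damping m0 m1 t * r' t
        - stiffness m0 m1 t * (sin (r t - pi/2) * cos (r t - pi/2))) (at t)"
      using r'[OF t] by (simp only: ode_rhs_eq_pendulum[OF t])
  qed
  have "r' c \<noteq> 0" if c: "c \<in> {0<..<pi/2}" "r c - pi/2 = 0" for c
  proof
    assume "r' c = 0"
    then have const: "r t = pi/2" if "t \<in> {0<..<pi/2}" for t
      using pendulum_double_zero_imp_zero[OF sol continuous_on_damping continuous_on_stiffness c(1)] c that
      by auto
    have "(0::real) \<in> {0..<pi/2}" by simp
    then have "continuous (at 0 within {0..<pi/2}) r" by (rule DERIV_continuous[OF r])
    then have "(r \<longlongrightarrow> 0) (at 0 within {0..<pi/2})" unfolding continuous_within r0 .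
    then have "(r \<longlongrightarrow> 0) (at_right 0)" 
      by (subst at_within_nhd[of 0 "{..<pi/2}" "{0<..}" "{0..<pi/2}"]) auto
    moreover have "(r \<longlongrightarrow> pi/2) (at_right 0)"
      by (rule tendsto_eventually)
        (use const in \<open>auto simp: eventually_at_right[of 0 "pi/2"] intro!: exI[of _ "pi/2"]\<close>)
    ultimately show False
      using tendsto_unique[of "at_right (0::real)" r] by force
  qed
  with sol show thesis using that by blast
qed

section \<open>Neighbourhoods containing at most one zero\<close>

text \<open>
  The quantification over all solutions inside the definition makes the neighbourhoods, and hence
  the final bound, independent of the initial velocity.
\<close>

definition separates_zeros :: "nat \<Rightarrow> nat \<Rightarrow> real set \<Rightarrow> bool" where
  "separates_zeros m0 m1 U \<longleftrightarrow>
     (\<forall>w w' a b. pendulum_solution (damping m0 m1) (stiffness m0 m1) {0<..<pi/2} w w' \<longrightarrow>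
        (\<forall>t\<in>{0<..<pi/2}. w t = 0 \<longrightarrow> w' t \<noteq> 0) \<longrightarrow>
        a \<in> U \<inter> {0<..<pi/2} \<longrightarrow> b \<in> U \<inter> {0<..<pi/2} \<longrightarrow> w a = 0 \<longrightarrow> w b = 0 \<longrightarrow> \<not> a < b)"

lemma separating_neighbourhoodI:
  assumes ev: "eventually Q (nhds c)"
    and sep: "\<And>w w' a b. pendulum_solution (damping m0 m1) (stiffness m0 m1) {a..b} w w' \<Longrightarrow>
        (\<And>t. t \<in> {a..b} \<Longrightarrow> w t = 0 \<Longrightarrow> w' t \<noteq> 0) \<Longrightarrow>
        (\<And>t. t \<in> {a..b} \<Longrightarrow> Q t \<and> t \<in> {0<..<pi/2}) \<Longrightarrow> w a = 0 \<Longrightarrow> w b = 0 \<Longrightarrow> \<not> a < b"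
  shows "\<exists>U. open U \<and> c \<in> U \<and> separates_zeros m0 m1 U"
proof -
  from ev obtain e where e: "e > 0" "\<And>t. dist t c < e \<Longrightarrow> Q t"
    by (auto simp: eventually_nhds_metric)
  have "separates_zeros m0 m1 (ball c e)"
    unfolding separates_zeros_def
  proof (intro allI impI)
    fix w w' a b
    assume sol: "pendulum_solution (damping m0 m1) (stiffness m0 m1) {0<..<pi/2} w w'"
      and simple: "\<forall>t\<in>{0<..<pi/2}. w t = 0 \<longrightarrow> w' t \<noteq> 0"
      and ab: "a \<in> ball c e \<inter> {0<..<pi/2}" "b \<in> ball c e \<inter> {0<..<pi/2}" and zeros: "w a = 0" "w b = 0"
    have sub: "{a..b} \<subseteq> ball c e \<inter> {0<..<pi/2}" using ab by (auto simp: dist_real_def)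
    show "\<not> a < b"
    proof (rule sep[where w = w and w' = w' and a = a and b = b])
      show "pendulum_solution (damping m0 m1) (stiffness m0 m1) {a..b} w w'"
        using sol sub by (auto simp: pendulum_solution_def)
      show "w' t \<noteq> 0" if "t \<in> {a..b}" "w t = 0" for t using that simple sub by blast
      show "Q t \<and> t \<in> {0<..<pi/2}" if "t \<in> {a..b}" for t
        using that sub e(2)[of t] by (auto simp: dist_commute)
    qed (fact zeros)+
  qed
  then show ?thesis using e(1) by (intro exI[of _ "ball c e"]) auto
qed

lemma eventually_nhds_less:
  fixes f :: "real \<Rightarrow> real"
  assumes "isCont f c" "f c < k"
  shows "eventually (\<lambda>t. f t < k) (nhds c)"
  using order_tendstoD(2)[OF assms(1)[unfolded continuous_at tendsto_at_iff_tendsto_nhds] assms(2)] .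

text \<open>
  The parabola \<open>y = 1 - K (t - c)\<^sup>2\<close> has \<open>y = 1\<close>, \<open>y' = 0\<close> and \<open>y'' = - 2 K\<close> at \<open>c\<close>, so for
  large \<open>K\<close> it is a strict positive supersolution at \<open>c\<close>, and near \<open>c\<close> by continuity.
\<close>

lemma separating_neighbourhood_interior:
  assumes c: "c \<in> {0<..<pi/2}"
  shows "\<exists>U. open U \<and> c \<in> U \<and> separates_zeros m0 m1 U"
proof -
  define K where "K = 1 + \<bar>stiffness m0 m1 c\<bar>"
  let ?y = "\<lambda>t. 1 - K * (t - c)\<^sup>2" and ?y' = "\<lambda>t. - 2 * K * (t - c)"
  let ?L = "\<lambda>t. - 2 * K + damping m0 m1 t * ?y' t + \<bar>stiffness m0 m1 t\<bar> * ?y t"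
  have cont: "isCont (damping m0 m1) c" "isCont (stiffness m0 m1) c"
    using continuous_on_damping continuous_on_stiffness c
    by (auto simp: continuous_on_eq_continuous_at)
  have "isCont ?L c" "isCont (\<lambda>t. - ?y t) c"
    by (intro continuous_intros cont)+
  then have "eventually (\<lambda>t. ?L t < 0) (nhds c)" "eventually (\<lambda>t. - ?y t < 0) (nhds c)"
    by (auto intro!: eventually_nhds_less simp: K_def simp del: minus_diff_eq)
  then have "eventually (\<lambda>t. ?L t < 0 \<and> - ?y t < 0) (nhds c)" by (rule eventually_conj)
  then show ?thesis
  proof (rule separating_neighbourhoodI)
    fix w w' a b
    assume sol: "pendulum_solution (damping m0 m1) (stiffness m0 m1) {a..b} w w'"
      and simple: "\<And>t. t \<in> {a..b} \<Longrightarrow> w t = 0 \<Longrightarrow> w' t \<noteq> 0"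
      and Q: "\<And>t. t \<in> {a..b} \<Longrightarrow> (?L t < 0 \<and> - ?y t < 0) \<and> t \<in> {0<..<pi/2}"
      and zeros: "w a = 0" "w b = 0"
    show "\<not> a < b"
      by (rule supersolution_imp_at_most_one_zero[where y = ?y and y' = ?y' and y'' = "\<lambda>_. - 2 * K",
            OF sol simple _ _ _ _ zeros])
        (use Q in \<open>auto intro!: derivative_eq_intros\<close>)
  qed
qed

text \<open>
  The supersolution is \<open>y = sin t powr (- 5/2)\<close>. After bounding \<open>\<bar>q\<bar>\<close> by
  \<open>m0 / sin\<^sup>2 t + m1 / cos\<^sup>2 t\<close>, the expression \<open>y'' + P y' + \<bar>q\<bar> y\<close> is at most
  \<open>y / sin\<^sup>2 t\<close> times a function that is continuous at \<open>0\<close> with value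
  \<open>35/4 - 5/2 m0 + m0 = (35 - 6 m0) / 4\<close>, which is negative for \<open>m0 \<ge> 6\<close>.
\<close>

lemma separating_neighbourhood_0:
  assumes "m0 \<ge> 6"
  shows "\<exists>U. open U \<and> 0 \<in> U \<and> separates_zeros m0 m1 U"
proof -
  let ?M0 = "real m0" and ?M1 = "real m1"
  let ?y = "\<lambda>t. sin t powr (-5/2)"
  let ?y' = "\<lambda>t. - 5/2 * (cos t / sin t) * ?y t"
  let ?y'' = "\<lambda>t. (35/4 * (cos t / sin t)\<^sup>2 + 5/2) * ?y t"
  let ?L = "\<lambda>t. 35/4 * (cos t)\<^sup>2 + 5/2 * (sin t)\<^sup>2 - 5/2 * ?M0 * (cos t)\<^sup>2 + 5/2 * ?M1 * (sin t)\<^sup>2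
      + ?M0 + ?M1 * (sin t / cos t)\<^sup>2"
  have "isCont ?L 0" by (intro continuous_intros) auto
  moreover have "?L 0 < 0" using assms by simp
  ultimately have "eventually (\<lambda>t. ?L t < 0) (nhds 0)" by (rule eventually_nhds_less)
  then show ?thesis
  proof (rule separating_neighbourhoodI)
    fix w w' a b
    assume sol: "pendulum_solution (damping m0 m1) (stiffness m0 m1) {a..b} w w'"
      and simple: "\<And>t. t \<in> {a..b} \<Longrightarrow> w t = 0 \<Longrightarrow> w' t \<noteq> 0"
      and Q: "\<And>t. t \<in> {a..b} \<Longrightarrow> ?L t < 0 \<and> t \<in> {0<..<pi/2}"
      and zeros: "w a = 0" "w b = 0"
    show "\<not> a < b"
    proof (rule supersolution_imp_at_most_one_zero[where y = ?y and y' = ?y' and y'' = ?y'',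
            OF sol simple _ _ _ _ zeros])
      fix t assume t: "t \<in> {a..b}"
      note pos = sin_cos_pos[OF conjunct2[OF Q[OF t]]]
      have dy: "(?y has_real_derivative ?y' t) (at t)"
        using pos by (auto intro!: derivative_eq_intros simp: field_simps powr_mult_base)
      then show "(?y has_real_derivative ?y' t) (at t)" .
      have dcot: "((\<lambda>t. cos t / sin t) has_real_derivative - 1 - (cos t / sin t)\<^sup>2) (at t)"
        using pos by (auto intro!: derivative_eq_intros simp: field_simps power2_eq_square)
      show "(?y' has_real_derivative ?y'' t) (at t)"
        by (rule derivative_eq_intros dcot dy refl)+ (simp add: algebra_simps power2_eq_square)
      show "0 < ?y t" using pos by simp
      have "\<bar>stiffness m0 m1 t\<bar> \<le> ?M0 / (sin t)\<^sup>2 + ?M1 / (cos t)\<^sup>2"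
        unfolding stiffness_def by (rule order_trans[OF abs_triangle_ineq4]) simp
      then have "?y'' t + damping m0 m1 t * ?y' t + \<bar>stiffness m0 m1 t\<bar> * ?y t
        \<le> ?y'' t + damping m0 m1 t * ?y' t + (?M0 / (sin t)\<^sup>2 + ?M1 / (cos t)\<^sup>2) * ?y t"
        using pos by (intro add_left_mono mult_right_mono) auto
      also have "\<dots> = ?L t * (?y t / (sin t)\<^sup>2)"
        using pos by (simp add: damping_def field_simps power2_eq_square)
      also have "\<dots> < 0"
        using Q[OF t] pos by (intro mult_neg_pos divide_pos_pos) auto
      finally show "?y'' t + damping m0 m1 t * ?y' t + \<bar>stiffness m0 m1 t\<bar> * ?y t < 0" .
    qed
  qed
qed

lemma has_real_derivative_power_logarithmic:
  fixes f :: "real \<Rightarrow> real"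
  assumes "(f has_real_derivative f') (at t)" "f t \<noteq> 0"
  shows "((\<lambda>t. f t ^ n) has_real_derivative real n * (f' / f t) * f t ^ n) (at t)"
  by (rule DERIV_cong[OF DERIV_power[OF assms(1), of n]]) (cases n; use assms(2) in simp)

text \<open>
  For \<open>p = (sin t)^m0 (cos t)^m1\<close> the derivative of \<open>p\<^sup>2 q\<close> is a positive function times
  \<open>X = (m0 cos\<^sup>2 t - m1 sin\<^sup>2 t)\<^sup>2 - m0 cos^4 t - m1 sin^4 t\<close>. At \<open>pi/2\<close> this equals
  \<open>m1\<^sup>2 - m1\<close>, which settles the sign for \<open>m1 \<ge> 2\<close>. For \<open>m1 = 1\<close> the value is zero; then a
  factor \<open>m0 cos\<^sup>2 t\<close> splits off, and the other factor is \<open>- 2\<close> at \<open>pi/2\<close>. So the energy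
  increases for \<open>m1 \<ge> 2\<close> and decreases for \<open>m1 = 1\<close>.
\<close>

lemma separating_neighbourhood_pi_half:
  assumes "m1 \<ge> 1"
  shows "\<exists>U. open U \<and> pi/2 \<in> U \<and> separates_zeros m0 m1 U"
proof -
  let ?M0 = "real m0" and ?M1 = "real m1"
  let ?X = "\<lambda>t. (?M0 * (cos t)\<^sup>2 - ?M1 * (sin t)\<^sup>2)\<^sup>2 - ?M0 * (cos t)^4 - ?M1 * (sin t)^4"
  have sign: "eventually (\<lambda>t. 0 \<le> ?X t) (nhds (pi/2)) \<or> eventually (\<lambda>t. ?X t \<le> 0) (nhds (pi/2))"
  proof (cases "m1 = 1")
    case True
    have "isCont (\<lambda>t::real. - ((cos t)\<^sup>2 + 2 * (sin t)\<^sup>2 - ?M0 * (cos t)\<^sup>2)) (pi/2)"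
      by (intro continuous_intros)
    then have "eventually (\<lambda>t. - ((cos t)\<^sup>2 + 2 * (sin t)\<^sup>2 - ?M0 * (cos t)\<^sup>2) < 0) (nhds (pi/2))"
      by (rule eventually_nhds_less) simp
    then have "eventually (\<lambda>t. ?X t \<le> 0) (nhds (pi/2))"
    proof eventually_elim
      case (elim t)
      have "?X t = ?M0 * (cos t)\<^sup>2 * - ((cos t)\<^sup>2 + 2 * (sin t)\<^sup>2 - ?M0 * (cos t)\<^sup>2)"
        using True by (simp add: algebra_simps power2_eq_square power4_eq_xxxx)
      then show ?case using elim by (simp add: mult_nonneg_nonpos)
    qed
    then show ?thesis ..
  next
    case False
    have "isCont (\<lambda>t. - ?X t) (pi/2)" by (intro continuous_intros)
    moreover have "?M1 < ?M1\<^sup>2" using False assms by (simp add: power2_eq_square)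
    ultimately have "eventually (\<lambda>t. - ?X t < 0) (nhds (pi/2))"
      by (intro eventually_nhds_less) simp_all
    then have "eventually (\<lambda>t. 0 \<le> ?X t) (nhds (pi/2))" by (rule eventually_mono) linarith
    then show ?thesis ..
  qed
  have "isCont (\<lambda>t::real. ?M0 * (cos t)\<^sup>2 - ?M1 * (sin t)\<^sup>2) (pi/2)" by (intro continuous_intros)
  then have neg: "eventually (\<lambda>t. ?M0 * (cos t)\<^sup>2 - ?M1 * (sin t)\<^sup>2 < 0) (nhds (pi/2))"
    by (rule eventually_nhds_less) (use assms in simp)
  let ?p = "\<lambda>t. sin t ^ m0 * cos t ^ m1" and ?q = "stiffness m0 m1"
  let ?k = "\<lambda>t. 2 * (?p t)\<^sup>2 / (sin t * cos t)^3 * ?X t"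
  have sep: "\<not> a < b"
    if sol: "pendulum_solution (damping m0 m1) ?q {a..b} w w'"
      and simple: "\<And>t. t \<in> {a..b} \<Longrightarrow> w t = 0 \<Longrightarrow> w' t \<noteq> 0"
      and I: "\<And>t. t \<in> {a..b} \<Longrightarrow> t \<in> {0<..<pi/2}"
      and neg: "\<And>t. t \<in> {a..b} \<Longrightarrow> ?M0 * (cos t)\<^sup>2 - ?M1 * (sin t)\<^sup>2 < 0"
      and sign: "(\<forall>t\<in>{a..b}. 0 \<le> ?X t) \<or> (\<forall>t\<in>{a..b}. ?X t \<le> 0)"
      and zeros: "w a = 0" "w b = 0" for w w' a b
  proof (rule monotone_energy_imp_at_most_one_zero[where p = ?p and k = ?k, OF sol simple _ _ _ _ _ zeros])
    fix t assume t: "t \<in> {a..b}"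
    note pos = sin_cos_pos[OF I[OF t]]
    show "0 < ?p t" using pos by simp
    have qeq: "?q t = (?M0 * (cos t)\<^sup>2 - ?M1 * (sin t)\<^sup>2) / (sin t * cos t)\<^sup>2"
      using pos by (simp add: stiffness_def field_simps)
    then show "?q t \<le> 0" using neg[OF t] by (simp add: divide_nonpos_nonneg)
    have dpow: "((\<lambda>t. sin t ^ m0) has_real_derivative ?M0 * (cos t / sin t) * sin t ^ m0) (at t)"
      "((\<lambda>t. cos t ^ m1) has_real_derivative - ?M1 * (sin t / cos t) * cos t ^ m1) (at t)"
      using pos by (auto intro!: DERIV_cong[OF has_real_derivative_power_logarithmic] derivative_intros)
    show dp: "(?p has_real_derivative ?p t * damping m0 m1 t) (at t)"
      by (rule derivative_eq_intros dpow refl)+ (simp add: damping_def algebra_simps)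
    have dq: "(?q has_real_derivative - 2 * ?M0 * (cos t / (sin t)^3) - 2 * ?M1 * (sin t / (cos t)^3)) (at t)"
      unfolding stiffness_def using pos
      by (auto intro!: derivative_eq_intros simp: field_simps power2_eq_square power3_eq_cube)
    have "2 * damping m0 m1 t * ?q t - 2 * ?M0 * (cos t / (sin t)^3) - 2 * ?M1 * (sin t / (cos t)^3)
        = 2 / (sin t * cos t)^3 * ?X t"
      unfolding qeq damping_def using pos
      by (simp add: divide_simps) (simp add: algebra_simps eval_nat_numeral)
    then have "?k t = (?p t)\<^sup>2 * (2 * damping m0 m1 t * ?q t - 2 * ?M0 * (cos t / (sin t)^3)
        - 2 * ?M1 * (sin t / (cos t)^3))"
      by simp
    then show "((\<lambda>t. (?p t)\<^sup>2 * ?q t) has_real_derivative ?k t) (at t)"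
      by (simp only:) (rule DERIV_cong[OF DERIV_mult[OF DERIV_power[OF dp, of 2] dq]],
          simp add: algebra_simps power2_eq_square)
  next
    have "0 \<le> 2 * (?p t)\<^sup>2 / (sin t * cos t)^3" if "t \<in> {a..b}" for t
      using sin_cos_pos[OF I[OF that]] by simp
    with sign show "(\<forall>t\<in>{a..b}. 0 \<le> ?k t) \<or> (\<forall>t\<in>{a..b}. ?k t \<le> 0)"
      by (metis (lifting) mult_nonneg_nonneg mult_nonneg_nonpos)
  qed
  from sign show ?thesis
  proof
    assume "eventually (\<lambda>t. 0 \<le> ?X t) (nhds (pi/2))"
    from eventually_conj[OF neg this] show ?thesis
    proof (rule separating_neighbourhoodI, goal_cases)
      case (1 w w' a b)
      show ?case by (rule sep[of a b w w', OF 1(1) 1(2) _ _ _ 1(4) 1(5)]) (use 1(3) in blast)+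
    qed
  next
    assume "eventually (\<lambda>t. ?X t \<le> 0) (nhds (pi/2))"
    from eventually_conj[OF neg this] show ?thesis
    proof (rule separating_neighbourhoodI, goal_cases)
      case (1 w w' a b)
      show ?case by (rule sep[of a b w w', OF 1(1) 1(2) _ _ _ 1(4) 1(5)]) (use 1(3) in blast)+
    qed
  qed
qed

section \<open>The uniform bound\<close>

theorem theoremC:
  fixes m0 m1 :: nat
  assumes "m0 \<ge> 6" and "m1 \<ge> 1"
  shows "\<exists>N::nat. \<forall>(v::real) (r::real \<Rightarrow> real).
           is_ivp_solution m0 m1 v r \<longrightarrow> nodal_number r \<le> enat N"
proof -
  have "\<exists>U. open U \<and> c \<in> U \<and> separates_zeros m0 m1 U" if "c \<in> {0..pi/2}" for c
  proof -
    from that consider "c = 0" | "c = pi/2" | "c \<in> {0<..<pi/2}" by fastforce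
    then show ?thesis
    proof cases
      case 1
      then show ?thesis using separating_neighbourhood_0[OF assms(1)] by simp
    next
      case 2
      show ?thesis unfolding 2 by (rule separating_neighbourhood_pi_half[OF assms(2)])
    next
      case 3
      then show ?thesis by (rule separating_neighbourhood_interior)
    qed
  qed
  then have "{0..pi/2} \<subseteq> \<Union>{U. open U \<and> separates_zeros m0 m1 U}" by blast
  then obtain \<U> where \<U>: "\<U> \<subseteq> {U. open U \<and> separates_zeros m0 m1 U}" "finite \<U>" "{0..pi/2} \<subseteq> \<Union>\<U>"
    by (rule compactE[OF compact_Icc]) blast+
  have "nodal_number r \<le> enat (card \<U>)" if ivp: "is_ivp_solution m0 m1 v r" for v r
  proof -
    define S where "S = {t \<in> {0<..<pi/2}. r t = pi/2}"
    obtain w' where sol: "pendulum_solution (damping m0 m1) (stiffness m0 m1) {0<..<pi/2} (\<lambda>t. r t - pi/2) w'"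
      and simple: "\<And>t. t \<in> {0<..<pi/2} \<Longrightarrow> r t - pi/2 = 0 \<Longrightarrow> w' t \<noteq> 0"
      using nodal_function[OF ivp] by blast
    have "S \<subseteq> {0..pi/2}" by (auto simp: S_def)
    then have "\<forall>t\<in>S. \<exists>U\<in>\<U>. t \<in> U" using \<U>(3) by blast
    then obtain f where f: "\<And>t. t \<in> S \<Longrightarrow> f t \<in> \<U> \<and> t \<in> f t" by metis
    \<comment> \<open>Distinct nodes lie in distinct members of the cover, so \<open>card \<U>\<close> bounds their number.\<close>
    have "inj_on f S"
    proof (rule linorder_inj_onI)
      fix a b assume ab: "a < b" "a \<in> S" "b \<in> S"
      have "separates_zeros m0 m1 (f a)" using f[OF ab(2)] \<U>(1) by blast
      moreover have "\<forall>t\<in>{0<..<pi/2}. r t - pi/2 = 0 \<longrightarrow> w' t \<noteq> 0" using simple by blast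
      ultimately have "\<not> a < b" if "b \<in> f a"
        using sol f[OF ab(2)] ab(2,3) that unfolding separates_zeros_def S_def
        by (elim allE[of _ "\<lambda>t. r t - pi/2"] allE[of _ w'] allE[of _ a] allE[of _ b]) auto
      then show "f a \<noteq> f b" using f[OF ab(3)] ab(1) by auto
    qed auto
    moreover have "f ` S \<subseteq> \<U>" using f by auto
    ultimately have "finite S" "card S \<le> card \<U>"
      using \<U>(2) by (auto intro: inj_on_finite card_inj_on_le)
    then show ?thesis by (simp add: nodal_number_def S_def)
  qed
  then show ?thesis by blast
qed

end
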